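(* Let $n\ge1$, $x,y$ coprime with $1\le x<y$, and consider the rotor multigraph $P^{x,y}_n$. For any integer $v\ge0$, we have $v\in g(\mathcal{R})$ if and only if the word $c[v]=(c_0,c_1,\dots,c_{n+1})$ belongs to the language described by the regular expression \[ e_d=\{0,\dots,y-1\}^*\cdot 0\cdot\{1,\dots,x\}^*\cdot 0 .\]
   Context: $P^{x,y}_n$ has vertices $u_0,\dots,u_{n+1}$; $u_0,u_{n+1}$ are sinks and $V_0=\{u_1,\dots,u_n\}$. For $1\le k\le n$, $u_k$ has outgoing arcs $a^k_0,\dots,a^k_{x+y-1}$, with $a^k_i$ going to $u_{k+1}$ for $0\le i\le x-1$ and to $u_{k-1}$ for $x\le i\le x+y-1$. A rotor configuration assigns to each $u\in V_0$ an outgoing arc $\rho(u)$; $\mathcal{R}$ is their set. With $h(u_0)=0$, $h(u_k)=\sum_{i=0}^{k-1}x^{n-i}y^i$, define $g(a^k_j)=\sum_{i=0}^{j-1}\big(h(\mathrm{head}(a^k_i))-h(u_k)\big)$, $g(\rho)=\sum_{u\in V_0}g(\rho(u))$, and $g(\mathcal{R})=\{g(\rho):\rho\in\mathcal{R}\}$. Let $d_k=x^{n-k}y^k$ ($0\le k\le n+1$). For an integer $v\ge0$, $c[v]=(c_0,\dots,c_{n+1})$ is its stable decomposition: the unique tuple with $v=\sum_{k=0}^{n+1}c_kd_k$, $c_k\in\{0,\dots,y-1\}$ for $0\le k\le n$ and $c_{n+1}\in x\mathbb{Z}$; it is viewed as a word of length $n+2$ over the alphabet $\mathbb{Z}$.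 In $e_d$, a set of integers denotes any single letter from that set, $\cdot$ is concatenation and $^*$ is Kleene star. *)

theory Defs
  imports Complex_Main "HOL-Library.FuncSet" "HOL-Number_Theory.Cong" "Graph_Theory.Digraph"
begin

text \<open>
  The path multigraph: the vertex \<open>u_k\<close> is the number \<open>k\<close>, and the arc \<open>a^k_i\<close> is the pair
  \<open>(k, i)\<close>. The sinks \<open>0\<close> and \<open>n + 1\<close> have no outgoing arcs.
\<close>

definition path_multigraph :: "nat \<Rightarrow> nat \<Rightarrow> nat \<Rightarrow> (nat, nat \<times> nat) pre_digraph" where
  "path_multigraph x y n =
     \<lparr> verts = {0..n + 1},
       arcs = {1..n} \<times> {0..<x + y},
       tail = fst,
       head = (\<lambda>(k, i). if i < x then k + 1 else k - 1) \<rparr>"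

lemma fin_digraph_path_multigraph: "fin_digraph (path_multigraph x y n)"
  by unfold_locales (auto simp: path_multigraph_def)

definition rotor_vertices :: "nat \<Rightarrow> nat set" where
  "rotor_vertices n = {1..n}"

definition rotor_configs :: "nat \<Rightarrow> nat \<Rightarrow> nat \<Rightarrow> (nat \<Rightarrow> nat \<times> nat) set" where
  "rotor_configs x y n =
     (\<Pi>\<^sub>E u\<in>rotor_vertices n. out_arcs (path_multigraph x y n) u)"

text \<open>
  The empty sum gives the value \<open>0\<close> at the sink \<open>0\<close>; since \<open>k \<le> n + 1\<close> on vertices, \<open>n - i\<close>
  is never truncated there. Arc weights run over the arcs before \<open>(k, j)\<close> in the rotor order at \<open>k\<close>.
\<close>

definition vertex_weight :: "nat \<Rightarrow> nat \<Rightarrow> nat \<Rightarrow> nat \<Rightarrow> int" where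
  "vertex_weight x y n k = (\<Sum>i<k. int x ^ (n - i) * int y ^ i)"

definition arc_weight :: "nat \<Rightarrow> nat \<Rightarrow> nat \<Rightarrow> nat \<times> nat \<Rightarrow> int" where
  "arc_weight x y n = (\<lambda>(k, j).
     \<Sum>i<j. vertex_weight x y n (head (path_multigraph x y n) (k, i)) - vertex_weight x y n k)"

definition config_weight :: "nat \<Rightarrow> nat \<Rightarrow> nat \<Rightarrow> (nat \<Rightarrow> nat \<times> nat) \<Rightarrow> int" where
  "config_weight x y n \<rho> = (\<Sum>u\<in>rotor_vertices n. arc_weight x y n (\<rho> u))"

text \<open>
  The last basis element \<open>x^(-1) y^(n+1)\<close> is in general not an integer, hence the rational
  values and the integer exponent.
\<close>

definition basis_elem :: "nat \<Rightarrow> nat \<Rightarrow> nat \<Rightarrow> nat \<Rightarrow> rat" where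
  "basis_elem x y n k = of_nat x powi (int n - int k) * of_nat y ^ k"

definition is_stable_decomp :: "nat \<Rightarrow> nat \<Rightarrow> nat \<Rightarrow> int \<Rightarrow> int list \<Rightarrow> bool" where
  "is_stable_decomp x y n v c \<longleftrightarrow>
     length c = n + 2 \<and>
     of_int v = (\<Sum>k=0..n + 1. of_int (c ! k) * basis_elem x y n k) \<and>
     (\<forall>k\<in>{0..n}. c ! k \<in> {0..int y - 1}) \<and>
     int x dvd c ! (n + 1)"

definition stable_decomp :: "nat \<Rightarrow> nat \<Rightarrow> nat \<Rightarrow> int \<Rightarrow> int list" where
  "stable_decomp x y n v = (THE c. is_stable_decomp x y n v c)"

lemma is_stable_decomp_iff:
  assumes "x \<ge> 1"
  shows "is_stable_decomp x y n v c \<longleftrightarrow>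
     length c = n + 2 \<and>
     int x * v = (\<Sum>k\<le>n + 1. c ! k * int x ^ (n + 1 - k) * int y ^ k) \<and>
     (\<forall>k<n + 1. 0 \<le> c ! k \<and> c ! k < int y) \<and> int x dvd c ! (n + 1)"
proof -
  have x0: "(of_nat x :: rat) \<noteq> 0" using assms by simp
  have summand: "of_nat x * (of_int (c ! k) * basis_elem x y n k) =
      (of_int (c ! k * int x ^ (n + 1 - k) * int y ^ k) :: rat)" if "k \<le> n + 1" for k
  proof -
    have "(of_nat x :: rat) ^ (n + 1 - k) = of_nat x powi int (n + 1 - k)"
      by (simp only: power_int_of_nat)
    also have "int (n + 1 - k) = 1 + (int n - int k)" using that by (simp add: of_nat_diff)
    also have "of_nat x powi (1 + (int n - int k)) = of_nat x * (of_nat x :: rat) powi (int n - int k)"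
      using x0 by (simp add: power_int_add)
    finally have "(of_nat x :: rat) ^ (n + 1 - k) = of_nat x * of_nat x powi (int n - int k)" .
    then show ?thesis by (simp only: basis_elem_def of_int_mult of_int_power of_int_of_nat_eq mult_ac)
  qed
  have "(of_int v = (\<Sum>k=0..n + 1. of_int (c ! k) * basis_elem x y n k)) \<longleftrightarrow>
      of_nat x * of_int v = of_nat x * (\<Sum>k=0..n + 1. of_int (c ! k) * basis_elem x y n k)"
    using x0 by simp
  also have "of_nat x * (\<Sum>k=0..n + 1. of_int (c ! k) * basis_elem x y n k) =
      (of_int (\<Sum>k\<le>n + 1. c ! k * int x ^ (n + 1 - k) * int y ^ k) :: rat)"
    unfolding sum_distrib_left of_int_sum atLeast0AtMost
    by (rule sum.cong[OF refl]) (use summand in auto)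
  also have "(of_nat x * of_int v :: rat) = of_int (int x * v)" by simp
  finally have "(of_int v = (\<Sum>k=0..n + 1. of_int (c ! k) * basis_elem x y n k)) \<longleftrightarrow>
      int x * v = (\<Sum>k\<le>n + 1. c ! k * int x ^ (n + 1 - k) * int y ^ k)"
    by (simp only: of_int_eq_iff)
  moreover have "(\<forall>k\<in>{0..n}. c ! k \<in> {0..int y - 1}) \<longleftrightarrow>
      (\<forall>k<n + 1. 0 \<le> c ! k \<and> c ! k < int y)"
    by (auto simp: less_Suc_eq_le)
  ultimately show ?thesis by (simp only: is_stable_decomp_def)
qed

lemma ex1_mixed_digits:
  fixes X Y w :: int
  assumes "coprime X Y" "Y \<ge> 1" "X dvd w"
  shows "\<exists>!c. length c = N + 1 \<and> w = (\<Sum>k\<le>N. c ! k * X ^ (N - k) * Y ^ k) \<and>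
     (\<forall>k<N. 0 \<le> c ! k \<and> c ! k < Y) \<and> X dvd c ! N"
  using assms(3)
proof (induction N arbitrary: w)
  case 0
  show ?case
  proof (rule ex1I[of _ "[w]"])
    show "c = [w]" if "length c = 0 + 1 \<and> w = (\<Sum>k\<le>0. c ! k * X ^ (0 - k) * Y ^ k) \<and>
      (\<forall>k<0. 0 \<le> c ! k \<and> c ! k < Y) \<and> X dvd c ! 0" for c
      using that by (cases c) auto
  qed (use 0 in auto)
next
  case (Suc N)
  define P where "P = (\<lambda>N w c. length c = N + 1 \<and> w = (\<Sum>k\<le>N. c ! k * X ^ (N - k) * Y ^ k) \<and>
     (\<forall>k<N. 0 \<le> c ! k \<and> c ! k < Y) \<and> X dvd c ! N)"
  have split: "P (Suc N) w (a # c) \<longleftrightarrow>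
      0 \<le> a \<and> a < Y \<and> (\<exists>w'. w = a * X ^ Suc N + Y * w' \<and> P N w' c)" for a c
  proof -
    have "(\<Sum>k\<le>Suc N. (a # c) ! k * X ^ (Suc N - k) * Y ^ k) =
        a * X ^ Suc N + Y * (\<Sum>k\<le>N. c ! k * X ^ (N - k) * Y ^ k)"
      by (subst sum.atMost_Suc_shift) (simp add: sum_distrib_left algebra_simps)
    then show ?thesis unfolding P_def by (simp add: All_less_Suc2) blast
  qed
  have cop: "coprime (X ^ Suc N) Y" using assms(1) by (rule coprime_power_left_iff[THEN iffD2, OF disjI1])
  obtain b where "[X ^ Suc N * b = w] (mod Y)"
    using cong_solve_coprime_int[OF cop] by (metis cong_scalar_right mult.assoc mult_1)
  moreover define a where "a = b mod Y"
  ultimately have "[X ^ Suc N * a = w] (mod Y)"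
    by (metis cong_def mod_mult_right_eq)
  then have "Y dvd w - a * X ^ Suc N"
    by (metis cong_iff_dvd_diff cong_sym mult.commute)
  then obtain w' where w': "w = a * X ^ Suc N + Y * w'"
    by (metis add.commute diff_add_cancel dvdE)
  have a: "0 \<le> a" "a < Y" using assms(2) by (auto simp: a_def)
  have "X dvd Y * w'"
    using Suc.prems w' by (metis dvd_add_right_iff dvd_mult dvd_triv_left power_Suc)
  then have "X dvd w'" using assms(1) by (simp add: coprime_dvd_mult_right_iff)
  then have "\<exists>!c. P N w' c" unfolding P_def by (rule Suc.IH)
  then obtain c where c: "P N w' c" "\<And>c'. P N w' c' \<Longrightarrow> c' = c"
    by blast
  have "\<exists>!c. P (Suc N) w c"
  proof (rule ex1I[of _ "a # c"])
    show "P (Suc N) w (a # c)" unfolding split using a w' c(1) by blast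
    fix e assume e: "P (Suc N) w e"
    then obtain a' c' where e_eq: "e = a' # c'" by (cases e) (auto simp: P_def)
    from e[unfolded e_eq split] obtain w''
      where a': "0 \<le> a'" "a' < Y" and w'': "w = a' * X ^ Suc N + Y * w''" and c': "P N w'' c'"
      by blast
    have "(a - a') * X ^ Suc N = Y * (w'' - w')" using w' w'' by (simp add: algebra_simps)
    then have "Y dvd (a - a') * X ^ Suc N" by simp
    then have "Y dvd a - a'" using cop by (simp add: coprime_dvd_mult_left_iff coprime_commute)
    then have "a = a'" using a a' by (metis mod_eq_dvd_iff mod_pos_pos_trivial)
    moreover from this have "w'' = w'" using w' w'' assms(2) by simp
    ultimately show "e = a # c" using c(2) c' e_eq by blast
  qed
  then show ?case unfolding P_def .
qed

lemma ex1_stable_decomp: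
  assumes "coprime x y" "1 \<le> x" "1 \<le> y"
  shows "\<exists>!c. is_stable_decomp x y n v c"
  using ex1_mixed_digits[of "int x" "int y" "int x * v" "n + 1"] assms
  by (simp add: is_stable_decomp_iff)

text \<open>Regular expressions whose atoms are sets of letters.\<close>

datatype 'a regexp =
    Letter "'a set"
  | Concat "'a regexp" "'a regexp"  (infixr \<open>\<cdot>\<close> 75)
  | Star "'a regexp"

primrec lang :: "'a regexp \<Rightarrow> 'a list set" where
  "lang (Letter A) = {[a] | a. a \<in> A}"
| "lang (Concat r s) = {u @ v | u v. u \<in> lang r \<and> v \<in> lang s}"
| "lang (Star r) = {concat ws | ws. set ws \<subseteq> lang r}"

definition e_d :: "nat \<Rightarrow> nat \<Rightarrow> int regexp" where
  "e_d x y =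
     Star (Letter {0..int y - 1}) \<cdot> Letter {0} \<cdot> Star (Letter {1..int x}) \<cdot> Letter {0}"

end

theory Submission
  imports Defs
begin

text \<open>
  Put \<open>d\<^sub>k = x^(n-k) y^k\<close>. Since \<open>x d\<^sub>k = y d\<^sub>k\<^sub>-\<^sub>1\<close>, the arcs at \<open>u\<^sub>k\<close> have the weights
  \<open>j d\<^sub>k\<close> with \<open>0 \<le> j \<le> x\<close> and \<open>m d\<^sub>k\<^sub>-\<^sub>1\<close> with \<open>1 \<le> m < y\<close>. Process the vertices
  \<open>u\<^sub>1, u\<^sub>2, \<dots>\<close> in order and normalise the digits after each step, starting from the word \<open>0\<close>. The
  first kind of arc appends the digit \<open>j\<close>. The second kind adds \<open>m\<close> to the last digit \<open>b\<close>; it then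
  appends \<open>0\<close> if \<open>b + m < y\<close>, and otherwise carries, replacing \<open>b\<close> by \<open>b + m - y < b\<close> and
  appending \<open>x\<close>. A carry forces \<open>b \<ge> 1\<close>, so \<open>b\<close> lies in the final block of digits from
  \<open>{1,\<dots>,x}\<close>, and either it stays there or it becomes the \<open>0\<close> that starts a new block. Conversely,
  in a word \<open>w 0 s\<close> of this shape the letters of \<open>w\<close> are realised by arcs of the second kind, those
  of \<open>s\<close> by arcs of the first kind.
\<close>

section \<open>Arc weights as multiples of basis elements\<close>

text \<open>An integer form of \<open>d_k\<close>. Only indices \<open>k \<le> n\<close> matter
  below, so the subtraction never truncates and the possibly fractional \<open>d_(n+1)\<close> is
  avoided.\<close>

definition base :: "nat \<Rightarrow> nat \<Rightarrow> nat \<Rightarrow> nat \<Rightarrow> int" where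
  "base x y n k = int x ^ (n - k) * int y ^ k"

lemma base_Suc:
  assumes "k < n"
  shows "int x * base x y n (Suc k) = int y * base x y n k"
proof -
  have "n - k = Suc (n - Suc k)" using assms by simp
  then show ?thesis by (simp add: base_def)
qed

text \<open>Each of the first \<open>x\<close> arcs at vertex \<open>Suc k\<close> contributes
  \<open>d_(k+1)\<close>, each later one \<open>-d_k\<close>. After \<open>x\<close> arcs the total
  \<open>x d_(k+1)\<close> equals \<open>y d_k\<close>, and the weights count down from
  there.\<close>

lemma arc_weight_eq:
  assumes "k < n"
  shows "arc_weight x y n (Suc k, j) =
    (if j \<le> x then int j * base x y n (Suc k) else (int y - int (j - x)) * base x y n k)"
proof (induction j)
  case 0
  then show ?case by (simp add: arc_weight_def)
next
  case (Suc j)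
  have step: "arc_weight x y n (Suc k, Suc j) =
      arc_weight x y n (Suc k, j) + (if j < x then base x y n (Suc k) else - base x y n k)"
    by (simp add: arc_weight_def path_multigraph_def vertex_weight_def base_def)
  consider "Suc j \<le> x" | "j = x" | "j > x" by linarith
  then show ?case
  proof cases
    case 2
    with step Suc.IH base_Suc[OF assms, of x y] show ?thesis by (simp add: algebra_simps)
  qed (use step Suc.IH in \<open>auto simp: algebra_simps of_nat_diff\<close>)
qed

lemma arc_weights_eq:
  assumes "k < n" "y \<ge> 1"
  shows "arc_weight x y n ` out_arcs (path_multigraph x y n) (Suc k) =
    (\<lambda>j. j * base x y n (Suc k)) ` {0..int x} \<union> (\<lambda>m. m * base x y n k) ` {1..int y - 1}"
    (is "?W = ?R \<union> ?L")
proof -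
  have W: "?W = (\<lambda>j. arc_weight x y n (Suc k, j)) ` {0..<x + y}"
    using assms(1) by (force simp: out_arcs_def path_multigraph_def)
  show ?thesis
  proof
    show "?W \<subseteq> ?R \<union> ?L"
    proof
      fix a assume "a \<in> ?W"
      then obtain j where j: "j < x + y" "a = arc_weight x y n (Suc k, j)" by (auto simp: W)
      show "a \<in> ?R \<union> ?L"
      proof (cases "j \<le> x")
        case True
        then have "a = int j * base x y n (Suc k)" using j arc_weight_eq[OF assms(1)] by simp
        then show ?thesis using True by auto
      next
        case False
        then have "a = (int y - int (j - x)) * base x y n k"
          using j arc_weight_eq[OF assms(1)] by simp
        then show ?thesis using False j(1) by auto
      qed
    qed
    have "j * base x y n (Suc k) \<in> ?W" if "j \<in> {0..int x}" for j
    proof -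
      have "j * base x y n (Suc k) = arc_weight x y n (Suc k, nat j)"
        using that by (simp add: arc_weight_eq[OF assms(1)] nat_le_iff)
      moreover have "nat j \<in> {0..<x + y}" using that assms(2) by auto
      ultimately show ?thesis unfolding W by (rule image_eqI)
    qed
    \<comment> \<open>The multiple \<open>m\<close> sits at arc number \<open>x + (y - m)\<close>;
      \<open>m = y\<close> would be arc \<open>x\<close>, already listed with the multiples of
      \<open>base x y n (Suc k)\<close>.\<close>
    moreover have "m * base x y n k \<in> ?W" if "m \<in> {1..int y - 1}" for m
    proof -
      have "\<not> x + (y - nat m) \<le> x" "int y - int (x + (y - nat m) - x) = m"
        using that by auto
      then have "m * base x y n k = arc_weight x y n (Suc k, x + (y - nat m))"
        by (simp only: arc_weight_eq[OF assms(1)] if_False)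
      moreover have "x + (y - nat m) \<in> {0..<x + y}" using that by auto
      ultimately show ?thesis unfolding W by (rule image_eqI)
    qed
    ultimately show "?R \<union> ?L \<subseteq> ?W" by blast
  qed
qed

text \<open>Vertices choose their arcs independently, so only the set of weights available at each
  vertex matters.\<close>

lemma sum_image_PiE:
  "(\<lambda>\<rho>. \<Sum>u\<in>I. f (\<rho> u)) ` (\<Pi>\<^sub>E u\<in>I. B u) = {\<Sum>u\<in>I. a u | a. \<forall>u\<in>I. a u \<in> f ` B u}"
proof (intro equalityI subsetI)
  fix s assume "s \<in> (\<lambda>\<rho>. \<Sum>u\<in>I. f (\<rho> u)) ` (\<Pi>\<^sub>E u\<in>I. B u)"
  then show "s \<in> {\<Sum>u\<in>I. a u | a. \<forall>u\<in>I. a u \<in> f ` B u}" by fastforce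
next
  fix s assume "s \<in> {\<Sum>u\<in>I. a u | a. \<forall>u\<in>I. a u \<in> f ` B u}"
  then obtain a where s: "s = (\<Sum>u\<in>I. a u)" and "\<forall>u\<in>I. \<exists>b. b \<in> B u \<and> a u = f b" by blast
  then obtain b where b: "\<forall>u\<in>I. b u \<in> B u \<and> a u = f (b u)" by metis
  show "s \<in> (\<lambda>\<rho>. \<Sum>u\<in>I. f (\<rho> u)) ` (\<Pi>\<^sub>E u\<in>I. B u)"
    by (rule image_eqI[of _ _ "restrict b I"]) (use s b in auto)
qed

section \<open>Digit words and their values\<close>

definition word_value :: "nat \<Rightarrow> nat \<Rightarrow> nat \<Rightarrow> int list \<Rightarrow> int" where
  "word_value x y n c = (\<Sum>i<length c. c ! i * base x y n i)"

lemma word_value_Nil [simp]: "word_value x y n [] = 0"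
  by (simp add: word_value_def)

lemma word_value_snoc [simp]:
  "word_value x y n (c @ [a]) = word_value x y n c + a * base x y n (length c)"
  by (simp add: word_value_def nth_append)

text \<open>The language of \<open>e_d\<close> with the final \<open>0\<close> removed. In a word of
  length \<open>n + 2\<close> that letter is the digit of \<open>d_(n+1)\<close>.\<close>

definition block_words :: "nat \<Rightarrow> nat \<Rightarrow> int list set" where
  "block_words x y = {w @ 0 # s | w s. set w \<subseteq> {0..int y - 1} \<and> set s \<subseteq> {1..int x}}"

lemma block_words_snoc_zero:
  "set w \<subseteq> {0..int y - 1} \<Longrightarrow> w @ [0] \<in> block_words x y"
  unfolding block_words_def by force

lemma block_words_snoc:
  assumes "c \<in> block_words x y" "1 \<le> a" "a \<le> int x"
  shows "c @ [a] \<in> block_words x y"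
proof -
  obtain w s where "c = w @ 0 # s" "set w \<subseteq> {0..int y - 1}" "set s \<subseteq> {1..int x}"
    using assms(1) by (auto simp: block_words_def)
  then have "c @ [a] = w @ 0 # (s @ [a])" "set w \<subseteq> {0..int y - 1}" "set (s @ [a]) \<subseteq> {1..int x}"
    using assms(2,3) by auto
  then show ?thesis unfolding block_words_def by blast
qed

lemma block_words_digits:
  assumes "c \<in> block_words x y" "x < y"
  shows "set c \<subseteq> {0..int y - 1}"
  using assms by (fastforce simp: block_words_def)

text \<open>The last letter is either the separating \<open>0\<close> or belongs to the final block,
  and then removing it leaves the separator in place.\<close>

lemma block_words_cases:
  assumes "c \<in> block_words x y"
  obtains (zero) w where "c = w @ [0]" "set w \<subseteq> {0..int y - 1}"
    | (pos) c' b where "c = c' @ [b]" "c' \<in> block_words x y" "1 \<le> b" "b \<le> int x"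
proof -
  obtain w s where c: "c = w @ 0 # s" "set w \<subseteq> {0..int y - 1}" "set s \<subseteq> {1..int x}"
    using assms by (auto simp: block_words_def)
  show thesis
  proof (cases s rule: rev_cases)
    case Nil
    then show thesis using c zero by simp
  next
    case (snoc s' b)
    then have "w @ 0 # s' \<in> block_words x y" using c unfolding block_words_def by auto
    then show thesis using c snoc pos[of "w @ 0 # s'" b] by simp
  qed
qed

section \<open>Correspondence between choices of arc weights and block words\<close>

lemma block_word_of_config:
  assumes "k \<le> n" "1 \<le> x" "x < y"
    and "\<forall>u\<in>{1..k}. a u \<in> arc_weight x y n ` out_arcs (path_multigraph x y n) u"
  shows "\<exists>c\<in>block_words x y. length c = k + 1 \<and> word_value x y n c = (\<Sum>u\<in>{1..k}. a u)"
  using assms(1,4)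
proof (induction k)
  case 0
  show ?case
    by (rule bexI[of _ "[0]"])
      (use block_words_snoc_zero[of "[]"] in \<open>auto simp: word_value_def\<close>)
next
  case (Suc k)
  then obtain c where c: "c \<in> block_words x y" "length c = k + 1"
    "word_value x y n c = (\<Sum>u\<in>{1..k}. a u)" by auto
  note digits = block_words_digits[OF c(1) assms(3)]
  have k: "k < n" using Suc.prems by simp
  have "a (Suc k) \<in> arc_weight x y n ` out_arcs (path_multigraph x y n) (Suc k)"
    using Suc.prems by simp
  then consider (right) j where "0 \<le> j" "j \<le> int x" "a (Suc k) = j * base x y n (Suc k)"
    | (left) m where "1 \<le> m" "m \<le> int y - 1" "a (Suc k) = m * base x y n k"
    using arc_weights_eq[OF k, of y x] assms by auto
  then have "\<exists>e\<in>block_words x y. length e = k + 2 \<and>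
      word_value x y n e = word_value x y n c + a (Suc k)"
  proof cases
    case right
    \<comment> \<open>\<open>j = 0\<close> becomes a new separator; \<open>j \<ge> 1\<close>
      prolongs the present final block.\<close>
    have "c @ [j] \<in> block_words x y"
      using block_words_snoc[OF c(1)] block_words_snoc_zero[OF digits] right
      by (cases "j = 0") auto
    then show ?thesis using c(2) right by (intro bexI[of _ "c @ [j]"]) auto
  next
    case left
    obtain c' b where cb: "c = c' @ [b]" using c(2) by (cases c rule: rev_cases) auto
    then have len: "length c' = k" using c(2) by simp
    show ?thesis
    proof (cases "b + m < int y")
      case True
      \<comment> \<open>All of \<open>c' @ [b + m]\<close> moves into the unrestricted prefix; the
        appended \<open>0\<close> is the separator.\<close>
      have "(c' @ [b + m]) @ [0] \<in> block_words x y"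
        by (rule block_words_snoc_zero) (use True digits cb left in auto)
      then show ?thesis
        using len cb left
        by (intro bexI[of _ "(c' @ [b + m]) @ [0]"]) (auto simp: algebra_simps word_value_snoc
            simp del: append_assoc)
    next
      case False
      \<comment> \<open>With \<open>b = 0\<close> no carry could occur, as \<open>m < y\<close>. So
        \<open>b\<close> is in the final block.\<close>
      then have "b \<noteq> 0" using left by simp
      with c(1) cb have c': "c' \<in> block_words x y" "1 \<le> b" "b \<le> int x"
        by (auto elim: block_words_cases)
      \<comment> \<open>The new digit is below \<open>b\<close>, hence still at most
        \<open>x\<close>; if it is \<open>0\<close>, it becomes the separator.\<close>
      have "c' @ [b + m - int y] \<in> block_words x y"
        using False left c' block_words_snoc[OF c'(1), of "b + m - int y"]
          block_words_snoc_zero[OF block_words_digits[OF c'(1) assms(3)]]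
        by (cases "b + m = int y") auto
      \<comment> \<open>The carry \<open>y d_k = x d_(k+1)\<close> yields the largest letter allowed
        in the final block.\<close>
      then have "(c' @ [b + m - int y]) @ [int x] \<in> block_words x y"
        by (rule block_words_snoc) (use assms in auto)
      moreover have "word_value x y n ((c' @ [b + m - int y]) @ [int x]) =
          word_value x y n c + a (Suc k)"
        unfolding word_value_snoc using len cb left base_Suc[OF k, of x y]
        by (simp add: algebra_simps)
      ultimately show ?thesis using len by (intro bexI) auto
    qed
  qed
  then show ?case using c(3) by auto
qed

lemma config_of_block_word:
  assumes "k \<le> n" "x < y" "c \<in> block_words x y" "length c = k + 1"
  shows "\<exists>a. (\<forall>u\<in>{1..k}. a u \<in> arc_weight x y n ` out_arcs (path_multigraph x y n) u) \<and>
    word_value x y n c = (\<Sum>u\<in>{1..k}. a u)"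
  using assms(1,3,4)
proof (induction k arbitrary: c)
  case 0
  then have "c = [0]" by (auto simp: block_words_def)
  then show ?case by (simp add: word_value_def)
next
  case (Suc k)
  have k: "k < n" using Suc.prems by simp
  note weights = arc_weights_eq[OF k, of y x]
  have "\<exists>c' b. c' \<in> block_words x y \<and> length c' = k + 1 \<and>
      b \<in> arc_weight x y n ` out_arcs (path_multigraph x y n) (Suc k) \<and>
      word_value x y n c = word_value x y n c' + b"
    using Suc.prems(2)
  proof (cases rule: block_words_cases)
    case (zero w)
    \<comment> \<open>Vertex \<open>Suc k\<close> realises the letter before the separator; putting
      \<open>0\<close> in its place gives a block word one letter shorter. For \<open>b = 0\<close>
      the arc of weight \<open>0\<close> serves.\<close>
    then obtain w' b where w: "w = w' @ [b]" "length w' = k"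
      using Suc.prems by (cases w rule: rev_cases) auto
    have b: "0 \<le> b" "b \<le> int y - 1" using zero w by auto
    have "b * base x y n k \<in> arc_weight x y n ` out_arcs (path_multigraph x y n) (Suc k)"
      using b assms(2) by (cases "b = 0") (auto simp: weights)
    moreover have "w' @ [0] \<in> block_words x y"
      by (rule block_words_snoc_zero) (use zero w in auto)
    moreover have "word_value x y n c = word_value x y n (w' @ [0]) + b * base x y n k"
      unfolding zero(1) word_value_snoc w by (simp add: w)
    moreover have "length (w' @ [0]) = k + 1" using w by simp
    ultimately show ?thesis by blast
  next
    case (pos c' b)
    \<comment> \<open>A letter of the final block is at most \<open>x\<close>, so it is a weight of
      the first kind.\<close>
    have "b * base x y n (Suc k) \<in> arc_weight x y n ` out_arcs (path_multigraph x y n) (Suc k)"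
      using pos assms(2) by (auto simp: weights)
    moreover have "length c' = k + 1" using pos Suc.prems by simp
    moreover from this have "word_value x y n c = word_value x y n c' + b * base x y n (Suc k)"
      using pos by simp
    ultimately show ?thesis using pos by blast
  qed
  then obtain c' b where c': "c' \<in> block_words x y" "length c' = k + 1"
    and b: "b \<in> arc_weight x y n ` out_arcs (path_multigraph x y n) (Suc k)"
    and v: "word_value x y n c = word_value x y n c' + b" by blast
  obtain a where a: "\<forall>u\<in>{1..k}. a u \<in> arc_weight x y n ` out_arcs (path_multigraph x y n) u"
    "word_value x y n c' = (\<Sum>u\<in>{1..k}. a u)" using Suc.IH[OF _ c'] k by auto
  have "(\<Sum>u\<in>{1..k}. (a(Suc k := b)) u) = (\<Sum>u\<in>{1..k}. a u)"
    by (rule sum.cong) auto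
  then have "word_value x y n c = (\<Sum>u\<in>{1..Suc k}. (a(Suc k := b)) u)"
    using a(2) v by simp
  moreover have "\<forall>u\<in>{1..Suc k}. (a(Suc k := b)) u \<in>
      arc_weight x y n ` out_arcs (path_multigraph x y n) u"
  proof
    fix u assume "u \<in> {1..Suc k}"
    then consider "u = Suc k" | "u \<in> {1..k}" "u \<noteq> Suc k" by force
    then show "(a(Suc k := b)) u \<in> arc_weight x y n ` out_arcs (path_multigraph x y n) u"
      by cases (use a(1) b in \<open>simp_all only: fun_upd_same fun_upd_other not_False_eq_True\<close>)
  qed
  ultimately show ?case by blast
qed

lemma config_weights_eq:
  assumes "1 \<le> x" "x < y"
  shows "config_weight x y n ` rotor_configs x y n =
    {word_value x y n c | c. c \<in> block_words x y \<and> length c = n + 1}"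
proof -
  have "config_weight x y n ` rotor_configs x y n = {\<Sum>u\<in>{1..n}. a u | a.
      \<forall>u\<in>{1..n}. a u \<in> arc_weight x y n ` out_arcs (path_multigraph x y n) u}"
    unfolding config_weight_def[abs_def] rotor_configs_def rotor_vertices_def
    by (rule sum_image_PiE)
  also have "\<dots> = {word_value x y n c | c. c \<in> block_words x y \<and> length c = n + 1}"
  proof (intro equalityI subsetI)
    fix s assume "s \<in> {\<Sum>u\<in>{1..n}. a u | a.
      \<forall>u\<in>{1..n}. a u \<in> arc_weight x y n ` out_arcs (path_multigraph x y n) u}"
    then obtain a where "s = (\<Sum>u\<in>{1..n}. a u)"
      "\<forall>u\<in>{1..n}. a u \<in> arc_weight x y n ` out_arcs (path_multigraph x y n) u" by blast
    then obtain c where "c \<in> block_words x y" "length c = n + 1" "s = word_value x y n c"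
      using block_word_of_config[OF le_refl assms, of n a] by auto
    then show "s \<in> {word_value x y n c | c. c \<in> block_words x y \<and> length c = n + 1}" by blast
  next
    fix s assume "s \<in> {word_value x y n c | c. c \<in> block_words x y \<and> length c = n + 1}"
    then obtain c where "s = word_value x y n c" "c \<in> block_words x y" "length c = n + 1" by blast
    then show "s \<in> {\<Sum>u\<in>{1..n}. a u | a.
      \<forall>u\<in>{1..n}. a u \<in> arc_weight x y n ` out_arcs (path_multigraph x y n) u}"
      using config_of_block_word[OF le_refl assms(2), of c n] by blast
  qed
  finally show ?thesis .
qed

section \<open>The language of \<open>e_d\<close> and the stable decomposition\<close>

lemma lang_Star_Letter: "lang (Star (Letter A)) = lists A"
proof (intro equalityI subsetI)
  fix w assume "w \<in> lang (Star (Letter A))"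
  then show "w \<in> lists A" by fastforce
next
  fix w assume "w \<in> lists A"
  then have "w = concat (map (\<lambda>a. [a]) w)" "set (map (\<lambda>a. [a]) w) \<subseteq> lang (Letter A)" by auto
  then show "w \<in> lang (Star (Letter A))" unfolding lang.simps(3) by blast
qed

lemma lang_e_d: "lang (e_d x y) = {c @ [0] | c. c \<in> block_words x y}"
  unfolding e_d_def lang.simps(2) lang_Star_Letter block_words_def lists_eq_set
  by auto (metis append_Cons append_assoc)+

text \<open>The last digit \<open>0\<close> removes \<open>d_(n+1)\<close> and meets the
  divisibility condition; the factor \<open>x\<close> in the integer form of the decomposition then
  cancels.\<close>

lemma is_stable_decomp_snoc_zero:
  assumes "1 \<le> x" "length c = n + 1" "set c \<subseteq> {0..int y - 1}"
  shows "is_stable_decomp x y n v (c @ [0]) \<longleftrightarrow> v = word_value x y n c"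
proof -
  have "(\<Sum>k\<le>n + 1. (c @ [0]) ! k * int x ^ (n + 1 - k) * int y ^ k) =
      (\<Sum>k<n + 1. (c @ [0]) ! k * int x ^ (n + 1 - k) * int y ^ k)"
    using assms(2) by (simp add: lessThan_Suc_atMost[symmetric] nth_append)
  also have "\<dots> = int x * word_value x y n c"
    unfolding word_value_def sum_distrib_left assms(2)
  proof (rule sum.cong)
    fix k assume "k \<in> {..<n + 1}"
    then show "(c @ [0]) ! k * int x ^ (n + 1 - k) * int y ^ k =
        int x * (c ! k * base x y n k)"
      using assms(2) by (simp add: nth_append base_def Suc_diff_le)
  qed simp
  finally have "(\<Sum>k\<le>n + 1. (c @ [0]) ! k * int x ^ (n + 1 - k) * int y ^ k) =
    int x * word_value x y n c" .
  moreover have "\<forall>k<n + 1. 0 \<le> (c @ [0]) ! k \<and> (c @ [0]) ! k < int y"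
  proof (intro allI impI)
    fix k assume "k < n + 1"
    moreover from this have "c ! k \<in> {0..int y - 1}" using assms(2,3) by (metis nth_mem subsetD)
    ultimately show "0 \<le> (c @ [0]) ! k \<and> (c @ [0]) ! k < int y"
      using assms(2) by (simp add: nth_append)
  qed
  moreover have "(c @ [0]) ! (n + 1) = 0" using assms(2) by (metis nth_append_length)
  ultimately show ?thesis
    unfolding is_stable_decomp_iff[OF assms(1)] using assms(1,2) by simp
qed

theorem theorem8:
  fixes n x y :: nat and v :: int
  assumes "n \<ge> 1"
    and "coprime x y"
    and "1 \<le> x" and "x < y"
    and "v \<ge> 0"
  shows "v \<in> config_weight x y n ` rotor_configs x y n \<longleftrightarrow>
         stable_decomp x y n v \<in> lang (e_d x y)"
proof -
  have ex1: "\<exists>!c. is_stable_decomp x y n v c"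
    by (rule ex1_stable_decomp) (use assms in auto)
  then have stable: "is_stable_decomp x y n v (stable_decomp x y n v)"
    unfolding stable_decomp_def by (rule theI')
  \<comment> \<open>Uniqueness of the decomposition turns equality of words into equality of values;
    \<open>x < y\<close> makes the letters of a block word legal digits.\<close>
  have eq_iff: "stable_decomp x y n v = c @ [0] \<longleftrightarrow> length c = n + 1 \<and> v = word_value x y n c"
    if "c \<in> block_words x y" for c
  proof
    assume eq: "stable_decomp x y n v = c @ [0]"
    then have "length c = n + 1" using stable by (auto simp: is_stable_decomp_def)
    with eq stable show "length c = n + 1 \<and> v = word_value x y n c"
      using is_stable_decomp_snoc_zero assms(3) block_words_digits[OF that assms(4)] by metis
  next
    assume "length c = n + 1 \<and> v = word_value x y n c"
    then have "is_stable_decomp x y n v (c @ [0])"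
      using is_stable_decomp_snoc_zero assms(3) block_words_digits[OF that assms(4)] by metis
    then show "stable_decomp x y n v = c @ [0]" using ex1 stable by blast
  qed
  show ?thesis
    unfolding config_weights_eq[OF assms(3,4)] lang_e_d using eq_iff by blast
qed

end
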